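(* Let points $M_1,\dots,M_N\in\mathbb R^k$ with masses $m_1,\dots,m_N>0$ be given, not all contained in one hyperplane, with total mass $m$, center of masses $C$, and central principal hyperplanar moments of inertia satisfying $0<J_1<J_2<\dots<J_k$. Use Cartesian coordinates $(x_1,\dots,x_k)$ with origin $C$ along the corresponding principal axes at $C$, and set $$a_s^2=\frac{J_s-J_1}{m},\qquad s=2,\dots,k .$$ Consider the family of all hyperplanes $\pi\subset\mathbb R^k$ for which the system of points has the same hyperplanar moment of inertia (equal to one fixed value). Then: (1) the envelope of all hyperplanes of this family that do not contain the origin is the quadric $$\frac{x_1^2}{A^2}+\frac{x_2^2}{A^2-a_2^2}+\dots+\frac{x_k^2}{A^2-a_k^2}=1$$ from the pencil of confocal quadrics obtained by varying the real parameter $A^2$, for a value of $A^2$ determined by the common value of the moment; (2) all hyperplanes of this family that contain the origin are asymptotically tangent at infinity to the same quadric from the pencil.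
   Context: For a hyperplane $\pi$, the hyperplanar moment of inertia is $J_\pi=\sum_{i=1}^N m_i d_i^2$, where $d_i$ is the perpendicular distance from $M_i$ to $\pi$. The center of masses is $C=\frac1m\sum_i m_iM_i$, $m=\sum_i m_i$. The central hyperplanar operator of inertia $J_C$ is the symmetric operator defined by $\langle J_C\mathbf n_1,\mathbf n_2\rangle=\sum_{j=1}^N m_j\langle \mathbf r_j,\mathbf n_1\rangle\langle\mathbf r_j,\mathbf n_2\rangle$ with $\mathbf r_j=M_j-C$. Its eigenvalues $J_1,\dots,J_k$ are the central principal hyperplanar moments of inertia, and its orthonormal eigenvectors give the principal axes at $C$ (the $x_i$-axis corresponds to $J_i$). The parameter $A^2$ is a real number, possibly negative. The pencil also includes degenerate quadrics: for $A^2=0$ the member is the coordinate hyperplane $x_1=0$, and for $A^2=a_s^2$ it is the coordinate hyperplane $x_s=0$ ($s=2,\dots,k$). A degenerate member is the enveloping quadric when the common moment equals some $J_i$; in that case the hyperplane with this moment is understood to coincide with the enveloping quadric, as a coordinate hyperplane. For a nondegenerate quadric, being the envelope of a family of hyperplanes means that the hyperplanes of the family are the tangent hyperplanes of the quadric. A hyperplane is asymptotically tangent at infinity to a quadric if its projective closure is tangent to the projective closure of the quadric at a point of the hyperplane at infinity.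
   Formalization: If the common moment equals J_s with s≥2, the envelope is not x_s=0 (for k=2 the lines pass through two foci); there it is only shown that x_s=0 is the one coordinate hyperplane of the family and that all its members are tangent to the double hyperplane x_s²=0 (singular points allowed). *)

theory Defs
  imports "HOL-Analysis.Analysis"
begin

definition is_hyperplane :: "'a::euclidean_space set \<Rightarrow> bool" where
  "is_hyperplane \<pi> \<longleftrightarrow> (\<exists>n c. n \<noteq> 0 \<and> \<pi> = {x. n \<bullet> x = c})"

text \<open>A system of points \<open>M 1, \<dots>, M N\<close> with masses \<open>\<mu> 1, \<dots>, \<mu> N\<close>.\<close>

definition total_mass :: "nat \<Rightarrow> (nat \<Rightarrow> real) \<Rightarrow> real" where
  "total_mass N \<mu> = (\<Sum>j=1..N. \<mu> j)"

definition mass_center :: "nat \<Rightarrow> (nat \<Rightarrow> real) \<Rightarrow> (nat \<Rightarrow> 'a::euclidean_space) \<Rightarrow> 'a" where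
  "mass_center N \<mu> M = (1 / total_mass N \<mu>) *\<^sub>R (\<Sum>j=1..N. \<mu> j *\<^sub>R M j)"

definition hyperplanar_moment ::
    "nat \<Rightarrow> (nat \<Rightarrow> real) \<Rightarrow> (nat \<Rightarrow> 'a::euclidean_space) \<Rightarrow> 'a set \<Rightarrow> real" where
  "hyperplanar_moment N \<mu> M \<pi> = (\<Sum>j=1..N. \<mu> j * (infdist (M j) \<pi>)\<^sup>2)"

definition equimomental_family ::
    "nat \<Rightarrow> (nat \<Rightarrow> real) \<Rightarrow> (nat \<Rightarrow> 'a::euclidean_space) \<Rightarrow> real \<Rightarrow> 'a set set" where
  "equimomental_family N \<mu> M h = {\<pi>. is_hyperplane \<pi> \<and> hyperplanar_moment N \<mu> M \<pi> = h}"

definition central_inertia_operator ::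
    "nat \<Rightarrow> (nat \<Rightarrow> real) \<Rightarrow> (nat \<Rightarrow> 'a::euclidean_space) \<Rightarrow> 'a \<Rightarrow> 'a" where
  "central_inertia_operator N \<mu> M n =
     (let r = (\<lambda>j. M j - mass_center N \<mu> M) in \<Sum>j=1..N. (\<mu> j * (r j \<bullet> n)) *\<^sub>R r j)"

text \<open>The explicit formula is the unique operator with the defining bilinear identity.\<close>

lemma central_inertia_operator_inner:
  "central_inertia_operator N \<mu> M n1 \<bullet> n2 =
     (\<Sum>j=1..N. \<mu> j * ((M j - mass_center N \<mu> M) \<bullet> n1) * ((M j - mass_center N \<mu> M) \<bullet> n2))"
  by (simp add: central_inertia_operator_def Let_def inner_sum_left)

lemma central_inertia_operator_unique:
  assumes "\<And>n1 n2. T n1 \<bullet> n2 =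
     (\<Sum>j=1..N. \<mu> j * ((M j - mass_center N \<mu> M) \<bullet> n1) * ((M j - mass_center N \<mu> M) \<bullet> n2))"
  shows "T = central_inertia_operator N \<mu> M"
proof
  fix n1
  show "T n1 = central_inertia_operator N \<mu> M n1"
    by (rule vector_eq_rdot[THEN iffD1]) (simp add: assms central_inertia_operator_inner)
qed

text \<open>Projective space is given by homogeneous coordinates \<open>(X, t) \<noteq> 0\<close> in \<open>'a \<times> real\<close>: the affine
  point \<open>X\<close> is \<open>(X, 1)\<close>, and the hyperplane at infinity is \<open>t = 0\<close>. The projective closure of an
  affine subspace \<open>\<pi>\<close> is represented by the linear subspace spanned by \<open>\<pi> \<times> {1}\<close>.\<close>

definition projective_closure :: "'a::euclidean_space set \<Rightarrow> ('a \<times> real) set" where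
  "projective_closure \<pi> = span ((\<lambda>X. (X, 1)) ` \<pi>)"

text \<open>The affine subspace \<open>H\<close> is tangent at \<open>p\<close> to the hypersurface \<open>F = 0\<close>. At a smooth point
  (nonzero derivative) a hyperplane \<open>H\<close> is then the usual tangent hyperplane; at a singular point
  of \<open>F = 0\<close> every hyperplane through the point counts as tangent, as usual in algebraic
  geometry.\<close>

definition tangent_at :: "('b::real_normed_vector \<Rightarrow> real) \<Rightarrow> 'b set \<Rightarrow> 'b \<Rightarrow> bool" where
  "tangent_at F H p \<longleftrightarrow> p \<in> H \<and> F p = 0 \<and>
     (\<exists>D. (F has_derivative D) (at p) \<and> (\<forall>y\<in>H. D (y - p) = 0))"

text \<open>A quadric is given by a quadratic form \<open>Q\<close> in the homogeneous coordinates \<open>(X, t)\<close>.\<close>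

definition affine_quadric :: "('a::euclidean_space \<times> real \<Rightarrow> real) \<Rightarrow> 'a set" where
  "affine_quadric Q = {X. Q (X, 1) = 0}"

definition tangent_hyperplane :: "('a::euclidean_space \<times> real \<Rightarrow> real) \<Rightarrow> 'a set \<Rightarrow> bool" where
  "tangent_hyperplane Q \<pi> \<longleftrightarrow> is_hyperplane \<pi> \<and> (\<exists>p. tangent_at (\<lambda>X. Q (X, 1)) \<pi> p)"

definition asymptotically_tangent :: "('a::euclidean_space \<times> real \<Rightarrow> real) \<Rightarrow> 'a set \<Rightarrow> bool" where
  "asymptotically_tangent Q \<pi> \<longleftrightarrow> is_hyperplane \<pi> \<and>
     (\<exists>v. v \<noteq> 0 \<and> tangent_at Q (projective_closure \<pi>) (v, 0))"

text \<open>Used for nondegenerate \<open>Q\<close> only.\<close>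

definition is_envelope :: "('a::euclidean_space \<times> real \<Rightarrow> real) \<Rightarrow> 'a set set \<Rightarrow> bool" where
  "is_envelope Q \<H> \<longleftrightarrow> \<H> = {\<pi>. tangent_hyperplane Q \<pi>}"

text \<open>The frame has origin \<open>C\<close> and axes \<open>e 1, \<dots>, e k\<close> with \<open>k = DIM('a)\<close>; the numbers
  \<open>asq 2, \<dots>, asq k\<close> are the \<open>a\<^sub>s\<^sup>2\<close> and \<open>A2\<close> is the (possibly negative) parameter \<open>A\<^sup>2\<close>.\<close>

definition coordinate_hyperplane ::
    "'a::euclidean_space \<Rightarrow> (nat \<Rightarrow> 'a) \<Rightarrow> nat \<Rightarrow> 'a set" where
  "coordinate_hyperplane C e i = {X. (X - C) \<bullet> e i = 0}"

definition degenerate_parameter :: "nat \<Rightarrow> (nat \<Rightarrow> real) \<Rightarrow> real \<Rightarrow> bool" where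
  "degenerate_parameter k asq A2 \<longleftrightarrow> A2 = 0 \<or> (\<exists>s\<in>{2..k}. A2 = asq s)"

text \<open>The degenerate members are the coordinate hyperplanes counted twice, \<open>x\<^sub>s\<^sup>2 = 0\<close>: this is what
  remains at \<open>A\<^sup>2 = a\<^sub>s\<^sup>2\<close> after clearing the denominators in the equation of the pencil. The sum in the
  second case has a single term when the \<open>a\<^sub>s\<^sup>2\<close> are distinct.\<close>

definition confocal_form ::
    "'a::euclidean_space \<Rightarrow> (nat \<Rightarrow> 'a) \<Rightarrow> (nat \<Rightarrow> real) \<Rightarrow> real \<Rightarrow> 'a \<times> real \<Rightarrow> real" where
  "confocal_form C e asq A2 = (\<lambda>(X, t).
     let x = (\<lambda>i. (X - t *\<^sub>R C) \<bullet> e i) in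
     if A2 = 0 then (x 1)\<^sup>2
     else if \<exists>s\<in>{2..DIM('a)}. A2 = asq s then \<Sum>s | s \<in> {2..DIM('a)} \<and> A2 = asq s. (x s)\<^sup>2
     else (x 1)\<^sup>2 / A2 + (\<Sum>s=2..DIM('a). (x s)\<^sup>2 / (A2 - asq s)) - t\<^sup>2)"

lemma affine_confocal_nondegenerate:
  fixes C :: "'a::euclidean_space"
  assumes "\<not> degenerate_parameter DIM('a) asq A2"
  shows "affine_quadric (confocal_form C e asq A2) =
    {X. ((X - C) \<bullet> e 1)\<^sup>2 / A2 + (\<Sum>s=2..DIM('a). ((X - C) \<bullet> e s)\<^sup>2 / (A2 - asq s)) = 1}"
  using assms by (auto simp: affine_quadric_def confocal_form_def degenerate_parameter_def)

lemma affine_confocal_zero: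
  "affine_quadric (confocal_form C e asq 0) = coordinate_hyperplane C e 1"
  by (auto simp: affine_quadric_def confocal_form_def coordinate_hyperplane_def)

lemma affine_confocal_degenerate:
  fixes C :: "'a::euclidean_space"
  assumes "s \<in> {2..DIM('a)}" "inj_on asq {2..DIM('a)}" "asq s \<noteq> 0"
  shows "affine_quadric (confocal_form C e asq (asq s)) = coordinate_hyperplane C e s"
proof -
  have "{j. j \<in> {2..DIM('a)} \<and> asq s = asq j} = {s}"
    using assms(1,2) by (auto dest: inj_onD)
  moreover have "\<exists>j\<in>{2..DIM('a)}. asq s = asq j"
    using assms(1) by blast
  ultimately show ?thesis
    using assms(3)
    by (simp add: affine_quadric_def confocal_form_def coordinate_hyperplane_def)
qed

end

theory Submission
  imports Defs
begin

text \<open>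
  Write a hyperplane as \<open>n \<bullet> (X - C) = d\<close> with \<open>n \<noteq> 0\<close>, and let \<open>n\<^sub>i = n \<bullet> e i\<close> be the
  coordinates of the normal in the principal frame. The parallel axis identity at the centre of
  masses (\<open>huygens_steiner\<close>) together with the diagonal form of the inertia operator shows that the
  moment equals \<open>h\<close> iff \<open>d\<^sup>2 = \<Sum>i. b\<^sub>i n\<^sub>i\<^sup>2\<close> with \<open>b\<^sub>i = (h - J\<^sub>i) / m\<close>
  (\<open>equimomental_iff\<close>). With \<open>A\<^sup>2 = (h - J\<^sub>1) / m\<close> this reads \<open>b\<^sub>1 = A\<^sup>2\<close> and
  \<open>b\<^sub>s = A\<^sup>2 - a\<^sub>s\<^sup>2\<close>, so the equimomental condition is exactly the equation of the dual quadric
  of \<open>\<Sum>i. x\<^sub>i\<^sup>2 / b\<^sub>i = 1\<close>, a member of the confocal pencil.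

  If all \<open>b\<^sub>i\<close> are nonzero, duality does the rest. A hyperplane with \<open>d \<noteq> 0\<close> satisfying the dual
  equation touches the quadric at the point with coordinates \<open>b\<^sub>i n\<^sub>i / d\<close>, and these are all its
  tangent hyperplanes (\<open>tangent_central_form_iff\<close>). When \<open>d = 0\<close> the pole escapes to the
  point at infinity in the direction \<open>v\<^sub>i = b\<^sub>i n\<^sub>i\<close>, which lies on the quadric because
  \<open>\<Sum>i. b\<^sub>i n\<^sub>i\<^sup>2 = 0\<close>; this is asymptotic tangency
  (\<open>asymptotically_tangent_central_form\<close>).

  If \<open>h = J\<^sub>s\<close>, then \<open>b\<^sub>s = 0\<close> and the quadric is the double hyperplane \<open>x\<^sub>s\<^sup>2 = 0\<close>. All its
  points are singular, so tangency only asks for a common point, finite when \<open>d \<noteq> 0\<close> and at infinity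
  when \<open>d = 0\<close>. A hyperplane parallel to \<open>x\<^sub>s = 0\<close> has \<open>d\<^sup>2 = b\<^sub>s n\<^sub>s\<^sup>2 = 0\<close>, which rules out
  the one case without a finite common point; at infinity the direction \<open>v\<close> above still works
  unless it vanishes, and then any other axis does (\<open>direction_in_degenerate_cone\<close>). For
  \<open>s = 1\<close> all \<open>b\<^sub>i\<close> with \<open>i \<noteq> 1\<close> are negative, which leaves only the hyperplane \<open>x\<^sub>1 = 0\<close>.
\<close>

section \<open>Hyperplanes and their moments\<close>

lemma is_hyperplane_centered:
  fixes C :: "'a::euclidean_space"
  assumes "is_hyperplane \<pi>"
  obtains n d where "n \<noteq> 0" "\<pi> = {X. n \<bullet> (X - C) = d}"
proof -
  from assms obtain n c where "n \<noteq> 0" "\<pi> = {X. n \<bullet> X = c}"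
    by (auto simp: is_hyperplane_def)
  then show thesis
    by (intro that[of n "c - n \<bullet> C"]) (auto simp: inner_diff_right)
qed

lemma is_hyperplane_centeredI:
  fixes C :: "'a::euclidean_space"
  assumes "n \<noteq> 0"
  shows "is_hyperplane {X. n \<bullet> (X - C) = d}"
  unfolding is_hyperplane_def
  by (rule exI[of _ n], rule exI[of _ "d + n \<bullet> C"]) (use assms in \<open>auto simp: inner_diff_right\<close>)

text \<open>The component \<open>w\<close> of \<open>g\<close> orthogonal to \<open>n\<close> is a direction of the hyperplane, so \<open>g\<close>
  annihilates it, and then \<open>w \<bullet> w = 0\<close>. Applied to a gradient \<open>g\<close>, this recovers the normal of
  a tangent hyperplane.\<close>

lemma annihilator_of_hyperplane_directions:
  fixes n g C p :: "'a::euclidean_space"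
  assumes n: "n \<noteq> 0" and p: "n \<bullet> (p - C) = d"
    and g: "\<And>y. n \<bullet> (y - C) = d \<Longrightarrow> g \<bullet> (y - p) = 0"
  obtains c where "g = c *\<^sub>R n"
proof -
  define c where "c = (g \<bullet> n) / (n \<bullet> n)"
  define w where "w = g - c *\<^sub>R n"
  have nw: "n \<bullet> w = 0"
    using n by (simp add: w_def c_def inner_diff_right inner_commute)
  then have "n \<bullet> (p + w - C) = d"
    using p by (simp add: inner_diff_right inner_add_right)
  from g[OF this] have "g \<bullet> w = 0" by simp
  moreover have "w \<bullet> w = g \<bullet> w - c * (n \<bullet> w)"
    unfolding w_def by (simp add: inner_diff_left)
  ultimately have "w = 0" using nw by simp
  then show thesis using that[of c] by (simp add: w_def)
qed

lemma infdist_hyperplane: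
  fixes n x C :: "'a::euclidean_space"
  assumes n: "n \<noteq> 0"
  shows "infdist x {X. n \<bullet> (X - C) = d} = \<bar>n \<bullet> (x - C) - d\<bar> / norm n"
proof (rule antisym)
  \<comment> \<open>the foot of the perpendicular dropped from \<open>x\<close>\<close>
  define q where "q = x - ((n \<bullet> (x - C) - d) / (n \<bullet> n)) *\<^sub>R n"
  have q: "q \<in> {X. n \<bullet> (X - C) = d}"
    using n by (simp add: q_def inner_diff_right)
  have "dist x q = \<bar>n \<bullet> (x - C) - d\<bar> / norm n"
    using n by (simp add: q_def dist_norm dot_square_norm power2_eq_square)
  then show "infdist x {X. n \<bullet> (X - C) = d} \<le> \<bar>n \<bullet> (x - C) - d\<bar> / norm n"
    using infdist_le[OF q, of x] by simp
  have "\<bar>n \<bullet> (x - C) - d\<bar> / norm n \<le> dist x y" if "n \<bullet> (y - C) = d" for y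
  proof -
    have "n \<bullet> (x - C) - d = n \<bullet> (x - y)"
      using that by (simp add: inner_diff_right)
    then have "\<bar>n \<bullet> (x - C) - d\<bar> \<le> norm n * dist x y"
      using Cauchy_Schwarz_ineq2[of n "x - y"] by (simp add: dist_norm)
    then show ?thesis using n by (simp add: field_simps)
  qed
  then show "\<bar>n \<bullet> (x - C) - d\<bar> / norm n \<le> infdist x {X. n \<bullet> (X - C) = d}"
    using q by (auto simp: infdist_def intro!: cINF_greatest)
qed

lemma mass_center_balance:
  fixes M :: "nat \<Rightarrow> 'a::euclidean_space"
  assumes "total_mass N \<mu> \<noteq> 0"
  shows "(\<Sum>j=1..N. \<mu> j *\<^sub>R (M j - mass_center N \<mu> M)) = 0"
proof -
  have "(\<Sum>j=1..N. \<mu> j *\<^sub>R (M j - mass_center N \<mu> M))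
      = (\<Sum>j=1..N. \<mu> j *\<^sub>R M j) - total_mass N \<mu> *\<^sub>R mass_center N \<mu> M"
    by (simp add: scaleR_diff_right sum_subtractf total_mass_def scaleR_left.sum)
  also have "\<dots> = 0"
    using assms by (simp add: mass_center_def)
  finally show ?thesis .
qed

text \<open>Expanding the squares \<open>(n \<bullet> (M j - C) - d)\<^sup>2\<close> leaves no term linear in \<open>d\<close>, since the weighted
  sum of the \<open>M j - C\<close> vanishes. Multiplying by \<open>n \<bullet> n\<close> keeps both sides quadratic in \<open>(n, d)\<close>,
  so that normals need not be normalised.\<close>

lemma huygens_steiner:
  fixes M :: "nat \<Rightarrow> 'a::euclidean_space"
  assumes m: "total_mass N \<mu> \<noteq> 0" and n: "n \<noteq> 0" and C: "C = mass_center N \<mu> M"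
  shows "hyperplanar_moment N \<mu> M {X. n \<bullet> (X - C) = d} * (n \<bullet> n)
    = central_inertia_operator N \<mu> M n \<bullet> n + total_mass N \<mu> * d\<^sup>2"
proof -
  have "hyperplanar_moment N \<mu> M {X. n \<bullet> (X - C) = d} * (n \<bullet> n)
      = (\<Sum>j=1..N. \<mu> j * (n \<bullet> (M j - C) - d)\<^sup>2)"
    using n by (simp add: hyperplanar_moment_def infdist_hyperplane power_divide
        dot_square_norm sum_distrib_right)
  also have "\<dots> = (\<Sum>j=1..N. \<mu> j * ((M j - C) \<bullet> n) * ((M j - C) \<bullet> n))
      - 2 * d * (n \<bullet> (\<Sum>j=1..N. \<mu> j *\<^sub>R (M j - C))) + total_mass N \<mu> * d\<^sup>2"
    by (simp add: inner_sum_right total_mass_def sum_distrib_left sum_distrib_right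
        flip: sum_subtractf sum.distrib)
      (intro sum.cong refl, simp add: inner_commute power2_eq_square algebra_simps)
  also have "n \<bullet> (\<Sum>j=1..N. \<mu> j *\<^sub>R (M j - C)) = 0"
    using mass_center_balance[OF m, of M] by (simp add: C)
  finally show ?thesis
    by (simp add: C central_inertia_operator_inner)
qed

section \<open>Orthonormal frames\<close>

locale orthonormal_frame =
  fixes C :: "'a::euclidean_space" and e :: "nat \<Rightarrow> 'a"
  assumes orthonormal:
    "\<And>i j. i \<in> {1..DIM('a)} \<Longrightarrow> j \<in> {1..DIM('a)} \<Longrightarrow> e i \<bullet> e j = (if i = j then 1 else 0)"
begin

text \<open>As many orthonormal vectors as the dimension span the space; the difference of the two sides is
  orthogonal to all of them, hence to itself.\<close>

lemma frame_expansion: "(\<Sum>i=1..DIM('a). (x \<bullet> e i) *\<^sub>R e i) = x"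
proof -
  let ?I = "{1..DIM('a)}"
  have inj: "inj_on e ?I"
    by (rule inj_onI) (metis orthonormal zero_neq_one)
  have "pairwise orthogonal (e ` ?I)"
    by (auto simp: pairwise_def orthogonal_def orthonormal)
  moreover have "0 \<notin> e ` ?I"
    using orthonormal by (metis imageE inner_zero_left zero_neq_one)
  ultimately have "independent (e ` ?I)"
    by (rule pairwise_orthogonal_independent)
  then have span: "span (e ` ?I) = UNIV"
    using card_eq_dim[of "e ` ?I" UNIV] inj by (auto simp: card_image)
  define w where "w = (\<Sum>i\<in>?I. (x \<bullet> e i) *\<^sub>R e i) - x"
  have "orthogonal w b" if "b \<in> e ` ?I" for b
    using that by (auto simp: w_def orthogonal_def inner_diff_left inner_sum_left orthonormal
        if_distrib[of "\<lambda>u. _ * u"] cong: if_cong)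
  then have "orthogonal w w"
    using span by (intro orthogonal_to_span[of w "e ` ?I" w]) auto
  then show ?thesis by (simp add: w_def orthogonal_def)
qed

lemma inner_frame: "x \<bullet> y = (\<Sum>i=1..DIM('a). (x \<bullet> e i) * (y \<bullet> e i))"
  by (subst (1) frame_expansion[symmetric, of x]) (simp add: inner_sum_left inner_commute[of y])

lemma frame_eqI: "(\<And>i. i \<in> {1..DIM('a)} \<Longrightarrow> x \<bullet> e i = y \<bullet> e i) \<Longrightarrow> x = y"
  by (subst (1 2) frame_expansion[symmetric]) (rule sum.cong, auto)

lemma inner_frame_sum:
  assumes "i \<in> {1..DIM('a)}"
  shows "(\<Sum>j=1..DIM('a). f j *\<^sub>R e j) \<bullet> e i = f i"
  using assms by (simp add: inner_sum_left orthonormal if_distrib[of "\<lambda>u. _ * u"] cong: if_cong)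

text \<open>The homogenised coordinate \<open>x\<^sub>i\<close> in the frame with origin \<open>C\<close>; at \<open>t = 1\<close> it is the affine
  coordinate \<open>(X - C) \<bullet> e i\<close>, at \<open>t = 0\<close> the component of a direction. It is linear on
  \<open>'a \<times> real\<close>, hence its own derivative.\<close>

definition coordinate :: "nat \<Rightarrow> 'a \<times> real \<Rightarrow> real" where
  "coordinate i = (\<lambda>(X, t). (X - t *\<^sub>R C) \<bullet> e i)"

lemma coordinate_has_derivative:
  "(coordinate i has_derivative coordinate i) (at p within S)"
proof -
  have eq: "coordinate i = (\<lambda>p. (fst p - snd p *\<^sub>R C) \<bullet> e i)"
    by (auto simp: coordinate_def)
  show ?thesis unfolding eq
    by (auto intro!: derivative_eq_intros)
qed

text \<open>The points at infinity of a hyperplane are its directions, because \<open>(v, 0)\<close> is the difference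
  of \<open>(C + v, 1)\<close> and \<open>(C, 1)\<close>. The homogenised equation holds on the spanning set, hence on the
  closure.\<close>

lemma projective_closure_hyperplane:
  assumes "n \<noteq> 0" "n \<bullet> v = 0"
  shows "(v, 0) \<in> projective_closure {X. n \<bullet> (X - C) = 0}"
    and "y \<in> projective_closure {X. n \<bullet> (X - C) = 0} \<Longrightarrow>
      (\<Sum>i=1..DIM('a). (n \<bullet> e i) * coordinate i y) = 0"
proof -
  let ?P = "(\<lambda>X. (X, 1::real)) ` {X. n \<bullet> (X - C) = 0}"
  have "(C + v, 1) \<in> span ?P" "(C, 1) \<in> span ?P"
    using assms by (auto intro!: span_base)
  from span_diff[OF this] show "(v, 0) \<in> projective_closure {X. n \<bullet> (X - C) = 0}"
    by (simp add: projective_closure_def)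
  have "?P \<subseteq> {y. n \<bullet> (fst y - snd y *\<^sub>R C) = 0}" by auto
  moreover have "subspace {y. n \<bullet> (fst y - snd y *\<^sub>R C) = 0}"
    by (auto simp: subspace_def algebra_simps inner_diff_right inner_add_right)
  ultimately have "span ?P \<subseteq> {y. n \<bullet> (fst y - snd y *\<^sub>R C) = 0}"
    by (rule span_minimal)
  moreover have "n \<bullet> (fst y - snd y *\<^sub>R C) = (\<Sum>i=1..DIM('a). (n \<bullet> e i) * coordinate i y)"
    by (subst inner_frame) (simp add: coordinate_def case_prod_beta)
  ultimately show "(\<Sum>i=1..DIM('a). (n \<bullet> e i) * coordinate i y) = 0"
    if "y \<in> projective_closure {X. n \<bullet> (X - C) = 0}"
    using that by (auto simp: projective_closure_def)
qed

section \<open>Tangency to central quadrics\<close>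

definition central_form :: "(nat \<Rightarrow> real) \<Rightarrow> 'a \<times> real \<Rightarrow> real" where
  "central_form b p = (\<Sum>i=1..DIM('a). (coordinate i p)\<^sup>2 / b i) - (snd p)\<^sup>2"

lemma central_form_has_derivative:
  "(central_form b has_derivative
     (\<lambda>y. 2 * (\<Sum>i=1..DIM('a). coordinate i p * coordinate i y / b i) - 2 * snd p * snd y)) (at p)"
proof -
  have "(central_form b has_derivative
     (\<lambda>y. (\<Sum>i=1..DIM('a). 2 * coordinate i p * coordinate i y / b i) - 2 * snd p * snd y)) (at p)"
    unfolding central_form_def
    by (auto intro!: derivative_eq_intros coordinate_has_derivative simp: divide_inverse algebra_simps)
  then show ?thesis by (simp add: sum_distrib_left mult.assoc)
qed

lemma affine_central_form_has_derivative:
  "((\<lambda>X. central_form b (X, 1)) has_derivative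
     (\<lambda>y. 2 * ((\<Sum>i=1..DIM('a). ((p - C) \<bullet> e i / b i) *\<^sub>R e i) \<bullet> y))) (at p)"
proof -
  have "((\<lambda>X. (X, 1::real)) has_derivative (\<lambda>y. (y, 0))) (at p)"
    by (auto intro!: derivative_eq_intros)
  from has_derivative_compose[OF this central_form_has_derivative]
  show ?thesis
    by (rule has_derivative_eq_rhs)
      (simp add: coordinate_def inner_sum_left inner_commute[of "e i" for i])
qed

text \<open>The right-hand side is the equation of the dual quadric. At a point \<open>p\<close> of the quadric half the
  gradient is the vector \<open>g\<close> with \<open>g\<^sub>i = p\<^sub>i / b\<^sub>i\<close>, and \<open>g \<bullet> (p - C) = 1\<close>. Tangency means that
  \<open>g = c n\<close>, so \<open>c d = 1\<close>, and substituting \<open>p\<^sub>i = b\<^sub>i g\<^sub>i\<close> into the equation of the quadric gives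
  the dual equation. Conversely, the same formulas give the point of contact
  \<open>p\<^sub>i = b\<^sub>i n\<^sub>i / d\<close>.\<close>

lemma tangent_central_form_iff:
  assumes n: "n \<noteq> 0" and b: "\<And>i. i \<in> {1..DIM('a)} \<Longrightarrow> b i \<noteq> 0"
  shows "tangent_hyperplane (central_form b) {X. n \<bullet> (X - C) = d} \<longleftrightarrow>
    d \<noteq> 0 \<and> d\<^sup>2 = (\<Sum>i=1..DIM('a). b i * (n \<bullet> e i)\<^sup>2)"
proof
  assume "tangent_hyperplane (central_form b) {X. n \<bullet> (X - C) = d}"
  then obtain p D where p: "n \<bullet> (p - C) = d" "central_form b (p, 1) = 0"
    and D: "((\<lambda>X. central_form b (X, 1)) has_derivative D) (at p)"
      "\<And>y. n \<bullet> (y - C) = d \<Longrightarrow> D (y - p) = 0"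
    by (auto simp: tangent_hyperplane_def tangent_at_def)
  define g where "g = (\<Sum>i=1..DIM('a). ((p - C) \<bullet> e i / b i) *\<^sub>R e i)"
  have ge: "g \<bullet> e i = (p - C) \<bullet> e i / b i" if "i \<in> {1..DIM('a)}" for i
    unfolding g_def using that by (rule inner_frame_sum)
  have "g \<bullet> (y - p) = 0" if "n \<bullet> (y - C) = d" for y
    using has_derivative_unique[OF D(1) affine_central_form_has_derivative] D(2)[OF that]
    by (simp add: g_def)
  from annihilator_of_hyperplane_directions[OF n p(1) this]
  obtain c where c: "g = c *\<^sub>R n" by blast
  have sq: "(\<Sum>i=1..DIM('a). ((p - C) \<bullet> e i)\<^sup>2 / b i) = 1"
    using p(2) by (simp add: central_form_def coordinate_def)
  have "g \<bullet> (p - C) = 1"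
    unfolding sq[symmetric] by (subst inner_frame) (simp add: ge power2_eq_square)
  then have cd: "c * d = 1" using p(1) by (simp add: c)
  have "c\<^sup>2 * (\<Sum>i=1..DIM('a). b i * (n \<bullet> e i)\<^sup>2) = (\<Sum>i=1..DIM('a). b i * (g \<bullet> e i)\<^sup>2)"
    by (simp add: c sum_distrib_left power_mult_distrib algebra_simps)
  also have "\<dots> = (\<Sum>i=1..DIM('a). ((p - C) \<bullet> e i)\<^sup>2 / b i)"
    by (intro sum.cong refl) (use b in \<open>simp add: ge power2_eq_square\<close>)
  also have "\<dots> = c\<^sup>2 * d\<^sup>2"
    using cd sq by (metis power_mult_distrib power_one)
  finally show "d \<noteq> 0 \<and> d\<^sup>2 = (\<Sum>i=1..DIM('a). b i * (n \<bullet> e i)\<^sup>2)"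
    using cd by auto
next
  assume d: "d \<noteq> 0 \<and> d\<^sup>2 = (\<Sum>i=1..DIM('a). b i * (n \<bullet> e i)\<^sup>2)"
  define x where "x = (\<Sum>i=1..DIM('a). (b i * (n \<bullet> e i) / d) *\<^sub>R e i)"
  have xe: "x \<bullet> e i = b i * (n \<bullet> e i) / d" if "i \<in> {1..DIM('a)}" for i
    unfolding x_def using that by (rule inner_frame_sum)
  have "n \<bullet> x = (\<Sum>i=1..DIM('a). b i * (n \<bullet> e i)\<^sup>2) / d"
    by (subst inner_frame) (simp add: xe power2_eq_square sum_divide_distrib algebra_simps)
  also have "\<dots> = d\<^sup>2 / d" using d by simp
  also have "\<dots> = d" by (simp add: power2_eq_square)
  finally have nx: "n \<bullet> x = d" .
  have "(\<Sum>i=1..DIM('a). (x \<bullet> e i)\<^sup>2 / b i) = (\<Sum>i=1..DIM('a). b i * (n \<bullet> e i)\<^sup>2 / d\<^sup>2)"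
    by (intro sum.cong refl) (use b in \<open>simp add: xe power2_eq_square\<close>)
  also have "\<dots> = (\<Sum>i=1..DIM('a). b i * (n \<bullet> e i)\<^sup>2) / d\<^sup>2"
    by (simp only: sum_divide_distrib)
  also have "(\<Sum>i=1..DIM('a). b i * (n \<bullet> e i)\<^sup>2) = d\<^sup>2" using d by simp
  also have "d\<^sup>2 / d\<^sup>2 = 1" using conjunct1[OF d] by simp
  finally have "central_form b (C + x, 1) = 0"
    by (simp add: central_form_def coordinate_def)
  moreover have "(\<Sum>i=1..DIM('a). ((C + x - C) \<bullet> e i / b i) *\<^sub>R e i) = (1 / d) *\<^sub>R n"
    by (rule frame_eqI, subst inner_frame_sum, assumption) (use b in \<open>simp add: xe\<close>)
  note affine_central_form_has_derivative[of b "C + x", unfolded this]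
  ultimately show "tangent_hyperplane (central_form b) {X. n \<bullet> (X - C) = d}"
    unfolding tangent_hyperplane_def tangent_at_def
    using nx is_hyperplane_centeredI[OF n]
    by (intro conjI exI[of _ "C + x"] exI) (auto simp: inner_diff_right inner_add_right)
qed

text \<open>The point of contact is the pole of the hyperplane: the direction \<open>v\<close> with
  \<open>v\<^sub>i = b\<^sub>i n\<^sub>i\<close>. Both its incidence with the hyperplane and its incidence with the quadric are the
  hypothesis \<open>cone\<close>, and the derivative there is twice the homogenised equation of the
  hyperplane.\<close>

lemma asymptotically_tangent_central_form:
  assumes n: "n \<noteq> 0" and b: "\<And>i. i \<in> {1..DIM('a)} \<Longrightarrow> b i \<noteq> 0"
    and cone: "(\<Sum>i=1..DIM('a). b i * (n \<bullet> e i)\<^sup>2) = 0"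
  shows "asymptotically_tangent (central_form b) {X. n \<bullet> (X - C) = 0}"
proof -
  define v where "v = (\<Sum>i=1..DIM('a). (b i * (n \<bullet> e i)) *\<^sub>R e i)"
  have ve: "v \<bullet> e i = b i * (n \<bullet> e i)" if "i \<in> {1..DIM('a)}" for i
    unfolding v_def using that by (rule inner_frame_sum)
  have "v \<noteq> 0"
  proof
    assume "v = 0"
    then have "n \<bullet> e i = 0 \<bullet> e i" if "i \<in> {1..DIM('a)}" for i
      using ve[OF that] b[OF that] by simp
    from frame_eqI[OF this] n show False by simp
  qed
  moreover have nv: "n \<bullet> v = 0"
    unfolding cone[symmetric]
    by (subst inner_frame) (simp add: ve power2_eq_square algebra_simps)
  moreover have "(\<Sum>i=1..DIM('a). (v \<bullet> e i)\<^sup>2 / b i) = (\<Sum>i=1..DIM('a). b i * (n \<bullet> e i)\<^sup>2)"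
    by (intro sum.cong refl) (use b in \<open>simp add: ve power2_eq_square\<close>)
  then have "central_form b (v, 0) = 0"
    using cone by (simp add: central_form_def coordinate_def)
  moreover have "(\<Sum>i=1..DIM('a). coordinate i (v, 0) * coordinate i (y - (v, 0)) / b i) = 0"
    if y: "y \<in> projective_closure {X. n \<bullet> (X - C) = 0}" for y
  proof -
    have "y - (v, 0) \<in> projective_closure {X. n \<bullet> (X - C) = 0}"
      using y projective_closure_hyperplane(1)[OF n nv]
      by (simp add: projective_closure_def span_diff)
    moreover have "(\<Sum>i=1..DIM('a). coordinate i (v, 0) * coordinate i (y - (v, 0)) / b i)
      = (\<Sum>i=1..DIM('a). (n \<bullet> e i) * coordinate i (y - (v, 0)))"
      by (intro sum.cong refl) (use b in \<open>simp add: ve coordinate_def[of _] case_prod_beta\<close>)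
    ultimately show ?thesis
      using projective_closure_hyperplane(2)[OF n nv] by simp
  qed
  ultimately show ?thesis
    unfolding asymptotically_tangent_def tangent_at_def
    using is_hyperplane_centeredI[OF n] projective_closure_hyperplane(1)[OF n nv]
      central_form_has_derivative[of b "(v, 0)"]
    by (intro conjI exI[of _ v] exI) auto
qed

section \<open>Tangency to double coordinate hyperplanes\<close>

text \<open>The derivative of a square vanishes where the square does, so any common point is a point of
  contact. The axis \<open>e i\<close> lies in \<open>x\<^sub>s = 0\<close> and is transversal to the other hyperplane, hence
  meets it.\<close>

lemma tangent_double_hyperplane:
  assumes n: "n \<noteq> 0" and i: "i \<in> {1..DIM('a)}" and s: "s \<in> {1..DIM('a)}"
    and "i \<noteq> s" "n \<bullet> e i \<noteq> 0"
  shows "tangent_hyperplane (\<lambda>p. (coordinate s p)\<^sup>2) {X. n \<bullet> (X - C) = d}"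
proof -
  define p where "p = C + (d / (n \<bullet> e i)) *\<^sub>R e i"
  have "coordinate s (p, 1) = 0"
    using assms by (simp add: coordinate_def p_def orthonormal)
  moreover have "((\<lambda>X. (coordinate s (X, 1))\<^sup>2) has_derivative
      (\<lambda>y. 2 * coordinate s (p, 1) * coordinate s (y, 0))) (at p)"
    by (auto intro!: derivative_eq_intros simp: coordinate_def)
  moreover have "n \<bullet> (p - C) = d"
    using assms by (simp add: p_def)
  ultimately show ?thesis
    unfolding tangent_hyperplane_def tangent_at_def
    using is_hyperplane_centeredI[OF n] by (intro conjI exI[of _ p] exI) auto
qed

lemma asymptotically_tangent_double_hyperplane:
  assumes n: "n \<noteq> 0" and v: "v \<noteq> 0" "n \<bullet> v = 0" "v \<bullet> e s = 0"
  shows "asymptotically_tangent (\<lambda>p. (coordinate s p)\<^sup>2) {X. n \<bullet> (X - C) = 0}"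
proof -
  have "coordinate s (v, 0) = 0"
    using v by (simp add: coordinate_def)
  moreover have "((\<lambda>p. (coordinate s p)\<^sup>2) has_derivative
      (\<lambda>y. 2 * coordinate s (v, 0) * coordinate s y)) (at (v, 0))"
    by (auto intro!: derivative_eq_intros coordinate_has_derivative)
  ultimately show ?thesis
    unfolding asymptotically_tangent_def tangent_at_def
    using v is_hyperplane_centeredI[OF n] projective_closure_hyperplane(1)[OF n v(2)]
    by (intro conjI exI[of _ v] exI) auto
qed

text \<open>The pole direction \<open>v\<^sub>i = b\<^sub>i n\<^sub>i\<close> of the nondegenerate case has \<open>v\<^sub>s = 0\<close> because
  \<open>b\<^sub>s = 0\<close>. If it vanishes, \<open>n\<close> is a multiple of \<open>e s\<close>, and every other axis is orthogonal to
  both.\<close>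

lemma direction_in_degenerate_cone:
  assumes dim: "2 \<le> DIM('a)" and s: "s \<in> {1..DIM('a)}" and bs: "b s = 0"
    and b: "\<And>i. i \<in> {1..DIM('a)} \<Longrightarrow> i \<noteq> s \<Longrightarrow> b i \<noteq> 0"
    and cone: "(\<Sum>i=1..DIM('a). b i * (n \<bullet> e i)\<^sup>2) = 0"
  obtains v where "v \<noteq> 0" "n \<bullet> v = 0" "v \<bullet> e s = 0"
proof -
  define v where "v = (\<Sum>i=1..DIM('a). (b i * (n \<bullet> e i)) *\<^sub>R e i)"
  have ve: "v \<bullet> e i = b i * (n \<bullet> e i)" if "i \<in> {1..DIM('a)}" for i
    unfolding v_def using that by (rule inner_frame_sum)
  show thesis
  proof (cases "v = 0")
    case False
    moreover have "n \<bullet> v = 0"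
      unfolding cone[symmetric]
      by (subst inner_frame) (simp add: ve power2_eq_square algebra_simps)
    moreover have "v \<bullet> e s = 0"
      using ve[OF s] bs by simp
    ultimately show thesis by (rule that)
  next
    case True
    define i where "i = (if s = 1 then 2 else 1 :: nat)"
    have i: "i \<in> {1..DIM('a)}" "i \<noteq> s" using dim by (auto simp: i_def)
    then have "n \<bullet> e i = 0" using ve[of i] b[of i] True by simp
    moreover have "e i \<noteq> 0" using orthonormal[of i i] i by auto
    moreover have "e i \<bullet> e s = 0" using i s by (simp add: orthonormal)
    ultimately show thesis using that by blast
  qed
qed

section \<open>The confocal pencil in frame coordinates\<close>

lemma confocal_form_central:
  assumes "\<not> degenerate_parameter DIM('a) asq A2"
    and b: "b 1 = A2" "\<And>s. s \<in> {2..DIM('a)} \<Longrightarrow> b s = A2 - asq s"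
  shows "confocal_form C e asq A2 = central_form b"
proof
  fix p :: "'a \<times> real"
  have "{1..DIM('a)} = insert 1 {2..DIM('a)}" using DIM_positive[where 'a='a] by auto
  then have "(\<Sum>i=1..DIM('a). (coordinate i p)\<^sup>2 / b i) =
      (coordinate 1 p)\<^sup>2 / A2 + (\<Sum>s=2..DIM('a). (coordinate s p)\<^sup>2 / (A2 - asq s))"
    using b by simp
  then show "confocal_form C e asq A2 p = central_form b p"
    using assms(1)
    by (auto simp: confocal_form_def central_form_def degenerate_parameter_def coordinate_def
        case_prod_beta Let_def)
qed

lemma confocal_form_zero: "confocal_form C e asq 0 = (\<lambda>p. (coordinate 1 p)\<^sup>2)"
  by (auto simp: confocal_form_def coordinate_def)

lemma confocal_form_degenerate:
  assumes s: "s \<in> {2..DIM('a)}" and inj: "inj_on asq {2..DIM('a)}" and "asq s \<noteq> 0"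
  shows "confocal_form C e asq (asq s) = (\<lambda>p. (coordinate s p)\<^sup>2)"
proof -
  have "{j. j \<in> {2..DIM('a)} \<and> asq s = asq j} = {s}"
    using s inj by (auto dest: inj_onD)
  moreover have "\<exists>j\<in>{2..DIM('a)}. asq s = asq j"
    using s by blast
  ultimately show ?thesis
    using assms(3) by (simp add: fun_eq_iff confocal_form_def coordinate_def)
qed

lemma coordinate_hyperplane_eq_iff:
  assumes "i \<in> {1..DIM('a)}" "s \<in> {1..DIM('a)}"
  shows "coordinate_hyperplane C e i = coordinate_hyperplane C e s \<longleftrightarrow> i = s"
proof
  assume eq: "coordinate_hyperplane C e i = coordinate_hyperplane C e s"
  show "i = s"
  proof (rule ccontr)
    assume "i \<noteq> s"
    then have "C + e i \<in> coordinate_hyperplane C e s"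
      "C + e i \<notin> coordinate_hyperplane C e i"
      using assms by (auto simp: coordinate_hyperplane_def orthonormal)
    with eq show False by simp
  qed
qed simp

end

section \<open>The equimomental family\<close>

text \<open>Moving \<open>J\<^sub>i n\<^sub>i\<^sup>2\<close> to the other side of the parallel axis identity and writing \<open>h (n \<bullet> n)\<close> in
  coordinates turns the condition of moment \<open>h\<close> into the dual equation of the quadric with
  coefficients \<open>b\<^sub>i = (h - J\<^sub>i) / m\<close>. The inertia operator is symmetric, so its quadratic form is
  diagonal in the principal frame.\<close>

lemma equimomental_iff:
  fixes M :: "nat \<Rightarrow> 'a::euclidean_space"
  assumes "orthonormal_frame e" and m: "total_mass N \<mu> > 0" and C: "C = mass_center N \<mu> M"
    and principal:
      "\<And>i. i \<in> {1..DIM('a)} \<Longrightarrow> central_inertia_operator N \<mu> M (e i) = J i *\<^sub>R e i"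
    and n: "n \<noteq> 0"
  shows "{X. n \<bullet> (X - C) = d} \<in> equimomental_family N \<mu> M h \<longleftrightarrow>
    d\<^sup>2 = (\<Sum>i=1..DIM('a). (h - J i) / total_mass N \<mu> * (n \<bullet> e i)\<^sup>2)"
proof -
  interpret orthonormal_frame C e by fact
  let ?T = "central_inertia_operator N \<mu> M"
  have sym: "?T n \<bullet> e i = J i * (n \<bullet> e i)" if "i \<in> {1..DIM('a)}" for i
  proof -
    have "?T n \<bullet> e i = ?T (e i) \<bullet> n"
      by (simp add: central_inertia_operator_inner mult.assoc mult.left_commute mult.commute)
    then show ?thesis using principal[OF that] by (simp add: inner_commute)
  qed
  have "?T n \<bullet> n = (\<Sum>i=1..DIM('a). J i * (n \<bullet> e i)\<^sup>2)"
    by (subst inner_frame) (simp add: sym power2_eq_square mult.assoc)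
  moreover have "n \<bullet> n = (\<Sum>i=1..DIM('a). (n \<bullet> e i)\<^sup>2)"
    by (subst inner_frame) (simp add: power2_eq_square)
  ultimately have sum: "h * (n \<bullet> n) - ?T n \<bullet> n = 
      total_mass N \<mu> * (\<Sum>i=1..DIM('a). (h - J i) / total_mass N \<mu> * (n \<bullet> e i)\<^sup>2)"
    using m by (simp add: sum_distrib_left left_diff_distrib flip: sum_subtractf)
  have "{X. n \<bullet> (X - C) = d} \<in> equimomental_family N \<mu> M h \<longleftrightarrow>
      hyperplanar_moment N \<mu> M {X. n \<bullet> (X - C) = d} * (n \<bullet> n) = h * (n \<bullet> n)"
    using n is_hyperplane_centeredI[OF n] by (simp add: equimomental_family_def)
  also have "\<dots> \<longleftrightarrow> total_mass N \<mu> * d\<^sup>2 = h * (n \<bullet> n) - ?T n \<bullet> n"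
    using huygens_steiner[OF _ n C, of d] m by auto
  also have "\<dots> \<longleftrightarrow> d\<^sup>2 = (\<Sum>i=1..DIM('a). (h - J i) / total_mass N \<mu> * (n \<bullet> e i)\<^sup>2)"
    unfolding sum using m by simp
  finally show ?thesis .
qed

text \<open>If there were no points, every hyperplane would contain all of them.\<close>

lemma total_mass_pos:
  fixes M :: "nat \<Rightarrow> 'a::euclidean_space"
  assumes "\<And>j. j \<in> {1..N} \<Longrightarrow> 0 < \<mu> j"
    and "\<nexists>\<pi>. is_hyperplane \<pi> \<and> (\<forall>j\<in>{1..N}. M j \<in> \<pi>)"
  shows "0 < total_mass N \<mu>"
proof -
  obtain n :: 'a where "n \<in> Basis" using nonempty_Basis by blast
  then have "is_hyperplane {X. n \<bullet> (X - 0) = 0}"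
    by (intro is_hyperplane_centeredI) auto
  then have "{1..N} \<noteq> {}" using assms(2) by blast
  then show ?thesis
    unfolding total_mass_def using assms(1) by (intro sum_pos) auto
qed

theorem theorem3p1:
  fixes M :: "nat \<Rightarrow> real ^ 'n" and \<mu> :: "nat \<Rightarrow> real" and N k :: nat
    and C :: "real ^ 'n" and e :: "nat \<Rightarrow> real ^ 'n" and J asq :: "nat \<Rightarrow> real"
  assumes dim: "k = CARD('n)" "2 \<le> k"
    and masses: "\<And>j. j \<in> {1..N} \<Longrightarrow> 0 < \<mu> j"
    and not_in_hyperplane: "\<nexists>\<pi>. is_hyperplane \<pi> \<and> (\<forall>j\<in>{1..N}. M j \<in> \<pi>)"
    and center: "C = mass_center N \<mu> M"
    and orthonormal:
      "\<And>i j. i \<in> {1..k} \<Longrightarrow> j \<in> {1..k} \<Longrightarrow> e i \<bullet> e j = (if i = j then 1 else 0)"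
    and principal: "\<And>i. i \<in> {1..k} \<Longrightarrow> central_inertia_operator N \<mu> M (e i) = J i *\<^sub>R e i"
    and J_pos: "0 < J 1"
    and J_less: "\<And>i j. 1 \<le> i \<Longrightarrow> i < j \<Longrightarrow> j \<le> k \<Longrightarrow> J i < J j"
    and asq: "\<And>s. s \<in> {2..k} \<Longrightarrow> asq s = (J s - J 1) / total_mass N \<mu>"
  shows "\<exists>A2 :: real \<Rightarrow> real. \<forall>h.
    (let \<F> = equimomental_family N \<mu> M h;
         Q = confocal_form C e asq (A2 h) in
      (h \<notin> J ` {1..k} \<longrightarrow>
         \<not> degenerate_parameter k asq (A2 h) \<and> is_envelope Q {\<pi>\<in>\<F>. C \<notin> \<pi>}) \<and>
      (\<forall>s\<in>{1..k}. h = J s \<longrightarrow>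
         A2 h = (if s = 1 then 0 else asq s) \<and>
         affine_quadric Q = coordinate_hyperplane C e s \<and>
         (\<forall>i\<in>{1..k}. coordinate_hyperplane C e i \<in> \<F> \<longleftrightarrow>
            coordinate_hyperplane C e i = affine_quadric Q) \<and>
         (s = 1 \<longrightarrow> \<F> = {affine_quadric Q}) \<and>
         (\<forall>\<pi>\<in>\<F>. C \<notin> \<pi> \<longrightarrow> tangent_hyperplane Q \<pi>)) \<and>
      (\<forall>\<pi>\<in>\<F>. C \<in> \<pi> \<longrightarrow> asymptotically_tangent Q \<pi>))"
proof -
  note k = dim(1)[symmetric]
  interpret orthonormal_frame C e
    by unfold_locales (simp add: k orthonormal)
  define m where "m = total_mass N \<mu>"
  have m: "m > 0" unfolding m_def by (rule total_mass_pos[OF masses not_in_hyperplane])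
  define A2 where "A2 = (\<lambda>h. (h - J 1) / m)"
  define b where "b = (\<lambda>h i. (h - J i) / m)"
  have J_inj: "J i = J j \<longleftrightarrow> i = j" if "i \<in> {1..k}" "j \<in> {1..k}" for i j
    using that J_less[of i j] J_less[of j i] by (cases i j rule: linorder_cases) auto
  have asq': "asq s = (J s - J 1) / m" if "s \<in> {2..k}" for s
    using asq[OF that] by (simp add: m_def)
  have inj: "inj_on asq {2..k}"
    using m by (auto simp: inj_on_def asq' J_inj)
  have asq_nz: "asq s \<noteq> 0" if "s \<in> {2..k}" for s
    using that m J_inj[of s 1] by (auto simp: asq')
  have family: "{X. n \<bullet> (X - C) = d} \<in> equimomental_family N \<mu> M h \<longleftrightarrow>
      d\<^sup>2 = (\<Sum>i=1..k. b h i * (n \<bullet> e i)\<^sup>2)" if "n \<noteq> 0" for n d h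
    using equimomental_iff[OF orthonormal_frame_axioms _ center _ that, of J d h] m
    by (simp add: k principal b_def m_def)
  have hyp: "is_hyperplane \<pi>" if "\<pi> \<in> equimomental_family N \<mu> M h" for \<pi> h
    using that by (simp add: equimomental_family_def)
  have nondegenerate: "\<not> degenerate_parameter k asq (A2 h)"
      "confocal_form C e asq (A2 h) = central_form (b h)"
      "\<And>i. i \<in> {1..k} \<Longrightarrow> b h i \<noteq> 0"
    if h: "h \<notin> J ` {1..k}" for h
  proof -
    show nd: "\<not> degenerate_parameter k asq (A2 h)"
      using h m dim(2) by (auto simp: degenerate_parameter_def A2_def asq')
    show "confocal_form C e asq (A2 h) = central_form (b h)"
      by (rule confocal_form_central)
        (use nd in \<open>auto simp: k A2_def b_def asq' simp flip: diff_divide_distrib\<close>)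
    show "b h i \<noteq> 0" if "i \<in> {1..k}" for i
      using that h m by (auto simp: b_def)
  qed
  have degenerate: "A2 (J s) = (if s = 1 then 0 else asq s)"
      "confocal_form C e asq (A2 (J s)) = (\<lambda>p. (coordinate s p)\<^sup>2)"
      "affine_quadric (confocal_form C e asq (A2 (J s))) = coordinate_hyperplane C e s"
      "b (J s) s = 0" "\<And>i. i \<in> {1..k} \<Longrightarrow> i \<noteq> s \<Longrightarrow> b (J s) i \<noteq> 0"
    if s: "s \<in> {1..k}" for s
  proof -
    show A2: "A2 (J s) = (if s = 1 then 0 else asq s)"
      using s by (auto simp: A2_def asq')
    show form: "confocal_form C e asq (A2 (J s)) = (\<lambda>p. (coordinate s p)\<^sup>2)"
      unfolding A2 using s inj asq_nz
      by (auto simp: confocal_form_zero k intro!: confocal_form_degenerate)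
    show "affine_quadric (confocal_form C e asq (A2 (J s))) = coordinate_hyperplane C e s"
      by (simp add: form affine_quadric_def coordinate_hyperplane_def coordinate_def)
    show "b (J s) s = 0" by (simp add: b_def)
    show "b (J s) i \<noteq> 0" if "i \<in> {1..k}" "i \<noteq> s" for i
      using that s m J_inj[of s i] by (auto simp: b_def)
  qed
  have envelope: "is_envelope (confocal_form C e asq (A2 h))
      {\<pi> \<in> equimomental_family N \<mu> M h. C \<notin> \<pi>}" if h: "h \<notin> J ` {1..k}" for h
  proof -
    have "\<pi> \<in> equimomental_family N \<mu> M h \<and> C \<notin> \<pi> \<longleftrightarrow>
        tangent_hyperplane (central_form (b h)) \<pi>" if \<pi>: "is_hyperplane \<pi>" for \<pi>
    proof -
      obtain n d where n: "n \<noteq> 0" and \<pi>: "\<pi> = {X. n \<bullet> (X - C) = d}"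
        using is_hyperplane_centered[OF \<pi>] .
      show ?thesis
        unfolding \<pi> using nondegenerate(3)[OF h]
        by (subst tangent_central_form_iff[OF n]) (auto simp: k family[OF n])
    qed
    then show ?thesis
      unfolding is_envelope_def nondegenerate(2)[OF h]
      using hyp tangent_hyperplane_def by blast
  qed
  have member: "coordinate_hyperplane C e i \<in> equimomental_family N \<mu> M (J s) \<longleftrightarrow> i = s"
    if i: "i \<in> {1..k}" and s: "s \<in> {1..k}" for i s
  proof -
    have "e i \<noteq> 0" using orthonormal[of i i] i by (auto simp: k)
    moreover have "(\<Sum>j=1..k. b (J s) j * (e i \<bullet> e j)\<^sup>2) = b (J s) i"
      using i by (simp add: orthonormal k if_distrib[of "\<lambda>u. _ * u\<^sup>2"] cong: if_cong)
    ultimately show ?thesis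
      using family[of "e i" 0 "J s"] degenerate(4,5)[OF s] i
      by (auto simp: coordinate_hyperplane_def inner_commute)
  qed
  \<comment> \<open>for the least moment the dual equation equates a square with a sum of nonpositive terms\<close>
  have only: "\<pi> = coordinate_hyperplane C e 1" if \<pi>: "\<pi> \<in> equimomental_family N \<mu> M (J 1)" for \<pi>
  proof -
    obtain n d where n: "n \<noteq> 0" and \<pi>_eq: "\<pi> = {X. n \<bullet> (X - C) = d}"
      using is_hyperplane_centered[OF hyp[OF \<pi>]] .
    have le: "b (J 1) i * (n \<bullet> e i)\<^sup>2 \<le> 0" if "i \<in> {1..k}" for i
    proof -
      have "J 1 \<le> J i" using that J_less[of 1 i] by (cases "i = 1") auto
      then show ?thesis using m by (auto simp: b_def divide_le_0_iff mult_le_0_iff)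
    qed
    have d: "d\<^sup>2 = (\<Sum>i=1..k. b (J 1) i * (n \<bullet> e i)\<^sup>2)"
      using \<pi> family[OF n] by (simp add: \<pi>_eq)
    moreover have "\<dots> \<le> 0" using le by (rule sum_nonpos)
    ultimately have "d\<^sup>2 \<le> 0" by (rule ord_eq_le_trans)
    then have d0: "d = 0" by simp
    then have z: "(\<Sum>i=1..k. - (b (J 1) i * (n \<bullet> e i)\<^sup>2)) = 0"
      using d by (simp add: sum_negf)
    have "- (b (J 1) i * (n \<bullet> e i)\<^sup>2) = 0" if "i \<in> {1..k}" for i
      using z that le by (subst (asm) sum_nonneg_eq_0_iff) auto
    then have zero: "n \<bullet> e i = 0" if "i \<in> {1..k}" "i \<noteq> 1" for i
      using that degenerate(5)[of 1 i] dim(2) by force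
    have "n = (n \<bullet> e 1) *\<^sub>R e 1"
      by (rule frame_eqI) (use zero dim(2) in \<open>auto simp: orthonormal k\<close>)
    then obtain c where c: "n = c *\<^sub>R e 1" by blast
    with n have "c \<noteq> 0" by auto
    then show ?thesis
      unfolding \<pi>_eq d0 by (auto simp: coordinate_hyperplane_def inner_commute c)
  qed
  have tangent: "tangent_hyperplane (confocal_form C e asq (A2 (J s))) \<pi>"
    if s: "s \<in> {1..k}" and \<pi>: "\<pi> \<in> equimomental_family N \<mu> M (J s)" "C \<notin> \<pi>" for s \<pi>
  proof -
    obtain n d where n: "n \<noteq> 0" and \<pi>_eq: "\<pi> = {X. n \<bullet> (X - C) = d}"
      using is_hyperplane_centered[OF hyp[OF \<pi>(1)]] .
    have d: "d \<noteq> 0" "d\<^sup>2 = (\<Sum>i=1..k. b (J s) i * (n \<bullet> e i)\<^sup>2)"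
      using \<pi> family[OF n] by (auto simp: \<pi>_eq)
    \<comment> \<open>since \<open>b\<^sub>s = 0\<close>, a nonzero \<open>d\<close> excludes the hyperplanes parallel to \<open>x\<^sub>s = 0\<close>\<close>
    then have "\<exists>i\<in>{1..k}. b (J s) i * (n \<bullet> e i)\<^sup>2 \<noteq> 0"
      by (metis (no_types, lifting) sum.neutral zero_eq_power2)
    then obtain i where "i \<in> {1..k}" "i \<noteq> s" "n \<bullet> e i \<noteq> 0"
      using degenerate(4)[OF s] by (metis mult_zero_left mult_zero_right zero_power2)
    then show ?thesis
      unfolding degenerate(2)[OF s] \<pi>_eq
      using s by (intro tangent_double_hyperplane[OF n, of i]) (auto simp: k)
  qed
  have asymptotic: "asymptotically_tangent (confocal_form C e asq (A2 h)) \<pi>"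
    if \<pi>: "\<pi> \<in> equimomental_family N \<mu> M h" "C \<in> \<pi>" for h \<pi>
  proof -
    obtain n d where n: "n \<noteq> 0" and \<pi>_eq: "\<pi> = {X. n \<bullet> (X - C) = d}"
      using is_hyperplane_centered[OF hyp[OF \<pi>(1)]] .
    have d: "d = 0" using \<pi>(2) by (simp add: \<pi>_eq)
    have cone: "(\<Sum>i=1..k. b h i * (n \<bullet> e i)\<^sup>2) = 0"
      using \<pi>(1) family[OF n, of d h] by (simp add: \<pi>_eq d)
    show ?thesis
    proof (cases "h \<in> J ` {1..k}")
      case False
      then show ?thesis
        unfolding nondegenerate(2)[OF False] \<pi>_eq d
        using nondegenerate(3)[OF False] cone
        by (intro asymptotically_tangent_central_form[OF n]) (auto simp: k)
    next
      case True
      then obtain s where s: "s \<in> {1..k}" and h: "h = J s" by blast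
      obtain v where "v \<noteq> 0" "n \<bullet> v = 0" "v \<bullet> e s = 0"
        by (rule direction_in_degenerate_cone[of s "b h" n])
          (use s h degenerate(4,5) dim(2) cone in \<open>auto simp: k\<close>)
      then show ?thesis
        unfolding h degenerate(2)[OF s] \<pi>_eq d
        by (rule asymptotically_tangent_double_hyperplane[OF n])
    qed
  qed
  have "1 \<in> {1..k}" using dim(2) by simp
  then have first: "equimomental_family N \<mu> M (J 1) = {coordinate_hyperplane C e 1}"
    using only member[of 1 1] by blast
  have at_principal_moment: "A2 h = (if s = 1 then 0 else asq s) \<and>
      affine_quadric (confocal_form C e asq (A2 h)) = coordinate_hyperplane C e s \<and>
      (\<forall>i\<in>{1..k}. coordinate_hyperplane C e i \<in> equimomental_family N \<mu> M h \<longleftrightarrow>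
         coordinate_hyperplane C e i = affine_quadric (confocal_form C e asq (A2 h))) \<and>
      (s = 1 \<longrightarrow> equimomental_family N \<mu> M h = {affine_quadric (confocal_form C e asq (A2 h))}) \<and>
      (\<forall>\<pi>\<in>equimomental_family N \<mu> M h. C \<notin> \<pi> \<longrightarrow>
         tangent_hyperplane (confocal_form C e asq (A2 h)) \<pi>)"
    if s: "s \<in> {1..k}" and h: "h = J s" for h s
  proof (intro conjI ballI impI)
    fix i assume "i \<in> {1..k}"
    then show "coordinate_hyperplane C e i \<in> equimomental_family N \<mu> M h \<longleftrightarrow>
        coordinate_hyperplane C e i = affine_quadric (confocal_form C e asq (A2 h))"
      unfolding h degenerate(3)[OF s]
      using member s coordinate_hyperplane_eq_iff[of i s] by (simp add: k)
  next
    assume "s = 1"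
    then show "equimomental_family N \<mu> M h = {affine_quadric (confocal_form C e asq (A2 h))}"
      unfolding h degenerate(3)[OF s] using first by simp
  qed (use degenerate(1,3)[OF s] tangent[OF s] in \<open>simp_all only: h\<close>)
  show ?thesis
    unfolding Let_def
    by (rule exI[of _ A2], rule allI)
      (rule conjI, rule impI, rule conjI, erule nondegenerate(1), erule envelope, rule conjI,
        rule ballI, rule impI, erule (1) at_principal_moment, rule ballI, rule impI,
        erule (1) asymptotic)
qed

end
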